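(* Let $\Gamma$ be an environment, $A$ a System F type and $M$ a good metaterm of $\lambda^{\mathsf F}_{\mathfrak m}$ such that $\mathrm{ver}_A(M^{\Gamma}) \twoheadrightarrow \star$. Then the $\beta$-normal form $M^{\downarrow}$ of $M$ is a System F term such that $\Gamma\vdash M^{\downarrow}:A$.
   Context: There are disjoint denumerable sets of type-variables $a,b,\dots$ and eigenvariables $\mathbf{a},\mathbf{b},\dots$. Types: $A,B ::= a \mid \mathbf{a} \mid A\Rightarrow B \mid \forall a.A$ (eigenvariables are never bound in types or terms). Terms: $t ::= x \mid \lambda x.t \mid t\,s \mid \Lambda a.t \mid t\,A$. Environments are finite sets of assignments $x:A$ to distinct variables. Typing: $\Gamma,x:A\vdash x:A$; from $\Gamma,x:A\vdash t:B$ infer $\Gamma\vdash\lambda x.t:A\Rightarrow B$; from $\Gamma\vdash t:A\Rightarrow B$ and $\Gamma\vdash s:A$ infer $\Gamma\vdash t\,s:B$; from $\Gamma\vdash t:A$ with $a$ not free in $\Gamma$ infer $\Gamma\vdash\Lambda a.t:\forall a.A$; from $\Gamma\vdash t:\forall a.A$ infer $\Gamma\vdash t\,B:A\{a:=B\}$. $\beta$-reduction on terms: $(\lambda x.t)s\to_\beta t\{x:=s\}$, $(\Lambda a.t)A\to_\beta t\{a:=A\}$, closed under contexts. Metaterms of $\lambda^{\mathsf F}_{\mathfrak m}$: $M,N ::= x \mid \lambda x.M \mid M\,N \mid \Lambda a.M \mid M\,A \mid \star \mid (M\triangleright N) \mid \mathrm{gen}_A \mid \mathrm{ver}_A(M)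 \mid \nu\mathbf{a}.M$. A metaterm is pure if built only from the first five productions (pure metaterms are identified with terms, and on them reduction coincides with $\beta$-reduction); good if pure and $\beta$-normalizing. Reduction $\to$ is the closure under arbitrary contexts of: (1) $(\lambda x.M)N\to M\{x:=N\}$; (2) $(\Lambda a.M)A\to M\{a:=A\}$; (3) $(\star\triangleright M)\to M$; (4) $\mathrm{ver}_{\mathbf{a}}(\mathrm{gen}_{\mathbf{a}})\to\star$ for eigenvariables $\mathbf{a}$; (5) $\mathrm{gen}_{A\Rightarrow B}\to\lambda x.(\mathrm{ver}_A(x)\triangleright\mathrm{gen}_B)$; (6) $\mathrm{ver}_{A\Rightarrow B}(M)\to\mathrm{ver}_B(M\,\mathrm{gen}_A)$; (7) $\mathrm{gen}_{\forall a.A}\to\Lambda a.\mathrm{gen}_A$; (8) $\mathrm{ver}_{\forall a.A}(M)\to\nu\mathbf{a}.\mathrm{ver}_{A\{a:=\mathbf{a}\}}(M\,\mathbf{a})$ with $\mathbf{a}$ fresh; (9) $\nu\mathbf{a}.M\to M$ if $\mathbf{a}$ not free in $M$. $\twoheadrightarrow$ is its reflexive-transitive closure. $M^{\Gamma}$ replaces each free occurrence of each $x$ with $x:A\in\Gamma$ by $\mathrm{gen}_A$. *)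

theory Defs
  imports Main
begin

text \<open>
  Types and metaterms are taken up to alpha-equivalence by means of de Bruijn indices. There are
  three separate index spaces, for term variables (bound by \<open>Lam\<close>), type variables (bound by
  \<open>All\<close> and \<open>TLam\<close>) and eigenvariables (bound by \<open>Nu\<close> only). A dangling
  index is a free variable, so each sort has denumerably many of them.
\<close>

datatype ty =
    TVar nat
  | EVar nat
  | Arr ty ty
  | All ty

datatype meta =
    Var nat
  | Lam meta
  | App meta meta
  | TLam meta
  | TApp meta ty
  | Star
  | Guard meta meta  \<comment> \<open>\<open>Guard M N\<close> is \<open>M \<triangleright> N\<close>\<close>
  | Gen ty
  | Ver ty meta
  | Nu meta

text \<open>
  Renamings: \<open>\<xi>\<close> acts on term variables, \<open>\<tau>\<close> on type variables,
  \<open>\<epsilon>\<close> on eigenvariables.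
\<close>

definition lift_ren :: "(nat \<Rightarrow> nat) \<Rightarrow> nat \<Rightarrow> nat" where
  "lift_ren \<rho> = case_nat 0 (Suc \<circ> \<rho>)"

primrec ren_ty :: "(nat \<Rightarrow> nat) \<Rightarrow> (nat \<Rightarrow> nat) \<Rightarrow> ty \<Rightarrow> ty" where
  "ren_ty \<tau> \<epsilon> (TVar n) = TVar (\<tau> n)"
| "ren_ty \<tau> \<epsilon> (EVar n) = EVar (\<epsilon> n)"
| "ren_ty \<tau> \<epsilon> (Arr A B) = Arr (ren_ty \<tau> \<epsilon> A) (ren_ty \<tau> \<epsilon> B)"
| "ren_ty \<tau> \<epsilon> (All A) = All (ren_ty (lift_ren \<tau>) \<epsilon> A)"

primrec ren :: "(nat \<Rightarrow> nat) \<Rightarrow> (nat \<Rightarrow> nat) \<Rightarrow> (nat \<Rightarrow> nat) \<Rightarrow> meta \<Rightarrow> meta" where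
  "ren \<xi> \<tau> \<epsilon> (Var n) = Var (\<xi> n)"
| "ren \<xi> \<tau> \<epsilon> (Lam M) = Lam (ren (lift_ren \<xi>) \<tau> \<epsilon> M)"
| "ren \<xi> \<tau> \<epsilon> (App M N) = App (ren \<xi> \<tau> \<epsilon> M) (ren \<xi> \<tau> \<epsilon> N)"
| "ren \<xi> \<tau> \<epsilon> (TLam M) = TLam (ren \<xi> (lift_ren \<tau>) \<epsilon> M)"
| "ren \<xi> \<tau> \<epsilon> (TApp M A) = TApp (ren \<xi> \<tau> \<epsilon> M) (ren_ty \<tau> \<epsilon> A)"
| "ren \<xi> \<tau> \<epsilon> Star = Star"
| "ren \<xi> \<tau> \<epsilon> (Guard M N) = Guard (ren \<xi> \<tau> \<epsilon> M) (ren \<xi> \<tau> \<epsilon> N)"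
| "ren \<xi> \<tau> \<epsilon> (Gen A) = Gen (ren_ty \<tau> \<epsilon> A)"
| "ren \<xi> \<tau> \<epsilon> (Ver A M) = Ver (ren_ty \<tau> \<epsilon> A) (ren \<xi> \<tau> \<epsilon> M)"
| "ren \<xi> \<tau> \<epsilon> (Nu M) = Nu (ren \<xi> \<tau> (lift_ren \<epsilon>) M)"

text \<open>Weakening by one fresh type variable, respectively one fresh eigenvariable.\<close>

abbreviation ty_tshift :: "ty \<Rightarrow> ty" where "ty_tshift \<equiv> ren_ty Suc id"
abbreviation ty_eshift :: "ty \<Rightarrow> ty" where "ty_eshift \<equiv> ren_ty id Suc"
abbreviation xshift :: "meta \<Rightarrow> meta" where "xshift \<equiv> ren Suc id id"
abbreviation tshift :: "meta \<Rightarrow> meta" where "tshift \<equiv> ren id Suc id"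
abbreviation eshift :: "meta \<Rightarrow> meta" where "eshift \<equiv> ren id id Suc"

text \<open>
  Simultaneous capture-avoiding substitutions: types for type variables in types and in metaterms,
  and metaterms for term variables in metaterms. The single substitutions \<open>[0 := _]\<close> also
  lower the remaining indices by one, since they are only used to remove a binder.
\<close>

primrec subst_ty :: "(nat \<Rightarrow> ty) \<Rightarrow> ty \<Rightarrow> ty" where
  "subst_ty \<theta> (TVar n) = \<theta> n"
| "subst_ty \<theta> (EVar n) = EVar n"
| "subst_ty \<theta> (Arr A B) = Arr (subst_ty \<theta> A) (subst_ty \<theta> B)"
| "subst_ty \<theta> (All A) = All (subst_ty (case_nat (TVar 0) (ty_tshift \<circ> \<theta>)) A)"

primrec tsubst :: "(nat \<Rightarrow> ty) \<Rightarrow> meta \<Rightarrow> meta" where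
  "tsubst \<theta> (Var n) = Var n"
| "tsubst \<theta> (Lam M) = Lam (tsubst \<theta> M)"
| "tsubst \<theta> (App M N) = App (tsubst \<theta> M) (tsubst \<theta> N)"
| "tsubst \<theta> (TLam M) = TLam (tsubst (case_nat (TVar 0) (ty_tshift \<circ> \<theta>)) M)"
| "tsubst \<theta> (TApp M A) = TApp (tsubst \<theta> M) (subst_ty \<theta> A)"
| "tsubst \<theta> Star = Star"
| "tsubst \<theta> (Guard M N) = Guard (tsubst \<theta> M) (tsubst \<theta> N)"
| "tsubst \<theta> (Gen A) = Gen (subst_ty \<theta> A)"
| "tsubst \<theta> (Ver A M) = Ver (subst_ty \<theta> A) (tsubst \<theta> M)"
| "tsubst \<theta> (Nu M) = Nu (tsubst (ty_eshift \<circ> \<theta>) M)"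

primrec subst :: "(nat \<Rightarrow> meta) \<Rightarrow> meta \<Rightarrow> meta" where
  "subst \<sigma> (Var n) = \<sigma> n"
| "subst \<sigma> (Lam M) = Lam (subst (case_nat (Var 0) (xshift \<circ> \<sigma>)) M)"
| "subst \<sigma> (App M N) = App (subst \<sigma> M) (subst \<sigma> N)"
| "subst \<sigma> (TLam M) = TLam (subst (tshift \<circ> \<sigma>) M)"
| "subst \<sigma> (TApp M A) = TApp (subst \<sigma> M) A"
| "subst \<sigma> Star = Star"
| "subst \<sigma> (Guard M N) = Guard (subst \<sigma> M) (subst \<sigma> N)"
| "subst \<sigma> (Gen A) = Gen A"
| "subst \<sigma> (Ver A M) = Ver A (subst \<sigma> M)"
| "subst \<sigma> (Nu M) = Nu (subst (eshift \<circ> \<sigma>) M)"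

definition ty_inst :: "ty \<Rightarrow> ty \<Rightarrow> ty"  (\<open>_[0 :=\<^sub>a _]\<close> [300, 0] 300) where
  "A[0 :=\<^sub>a B] = subst_ty (case_nat B TVar) A"

definition tinst :: "meta \<Rightarrow> ty \<Rightarrow> meta"  (\<open>_[0 :=\<^sub>t _]\<close> [300, 0] 300) where
  "M[0 :=\<^sub>t A] = tsubst (case_nat A TVar) M"

definition inst :: "meta \<Rightarrow> meta \<Rightarrow> meta"  (\<open>_[0 :=\<^sub>x _]\<close> [300, 0] 300) where
  "M[0 :=\<^sub>x N] = subst (case_nat N Var) M"

inductive ctxt_closure :: "(meta \<Rightarrow> meta \<Rightarrow> bool) \<Rightarrow> meta \<Rightarrow> meta \<Rightarrow> bool" for R where
  base: "R M N \<Longrightarrow> ctxt_closure R M N"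
| Lam: "ctxt_closure R M M' \<Longrightarrow> ctxt_closure R (Lam M) (Lam M')"
| AppL: "ctxt_closure R M M' \<Longrightarrow> ctxt_closure R (App M N) (App M' N)"
| AppR: "ctxt_closure R N N' \<Longrightarrow> ctxt_closure R (App M N) (App M N')"
| TLam: "ctxt_closure R M M' \<Longrightarrow> ctxt_closure R (TLam M) (TLam M')"
| TApp: "ctxt_closure R M M' \<Longrightarrow> ctxt_closure R (TApp M A) (TApp M' A)"
| GuardL: "ctxt_closure R M M' \<Longrightarrow> ctxt_closure R (Guard M N) (Guard M' N)"
| GuardR: "ctxt_closure R N N' \<Longrightarrow> ctxt_closure R (Guard M N) (Guard M N')"
| Ver: "ctxt_closure R M M' \<Longrightarrow> ctxt_closure R (Ver A M) (Ver A M')"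
| Nu: "ctxt_closure R M M' \<Longrightarrow> ctxt_closure R (Nu M) (Nu M')"

inductive beta_root :: "meta \<Rightarrow> meta \<Rightarrow> bool" where
  beta: "beta_root (App (Lam M) N) (M[0 :=\<^sub>x N])"
| tbeta: "beta_root (TApp (TLam M) A) (M[0 :=\<^sub>t A])"

text \<open>
  In the rule \<open>nu_gc\<close>, the body of \<open>Nu\<close> does not contain the bound eigenvariable
  precisely when it is of the form \<open>eshift M\<close>; \<open>M\<close> is then that body
  seen outside of the binder.
\<close>

inductive red_root :: "meta \<Rightarrow> meta \<Rightarrow> bool" where
  beta: "red_root (App (Lam M) N) (M[0 :=\<^sub>x N])"
| tbeta: "red_root (TApp (TLam M) A) (M[0 :=\<^sub>t A])"
| guard: "red_root (Guard Star M) M"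
| ver_gen: "red_root (Ver (EVar n) (Gen (EVar n))) Star"
| gen_arr: "red_root (Gen (Arr A B)) (Lam (Guard (Ver A (Var 0)) (Gen B)))"
| ver_arr: "red_root (Ver (Arr A B) M) (Ver B (App M (Gen A)))"
| gen_all: "red_root (Gen (All A)) (TLam (Gen A))"
| ver_all: "red_root (Ver (All A) M)
     (Nu (Ver ((ty_eshift A)[0 :=\<^sub>a EVar 0]) (TApp (eshift M) (EVar 0))))"
| nu_gc: "red_root (Nu (eshift M)) M"

abbreviation beta_red :: "meta \<Rightarrow> meta \<Rightarrow> bool"  (infix \<open>\<rightarrow>\<^sub>\<beta>\<close> 50) where
  "beta_red \<equiv> ctxt_closure beta_root"

abbreviation beta_reds :: "meta \<Rightarrow> meta \<Rightarrow> bool"  (infix \<open>\<rightarrow>\<^sub>\<beta>\<^sup>*\<close> 50) where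
  "beta_reds \<equiv> beta_red\<^sup>*\<^sup>*"

abbreviation red :: "meta \<Rightarrow> meta \<Rightarrow> bool"  (infix \<open>\<rightarrow>\<^sub>m\<close> 50) where
  "red \<equiv> ctxt_closure red_root"

abbreviation reds :: "meta \<Rightarrow> meta \<Rightarrow> bool"  (infix \<open>\<rightarrow>\<^sub>m\<^sup>*\<close> 50) where
  "reds \<equiv> red\<^sup>*\<^sup>*"

text \<open>Terms are identified with pure metaterms.\<close>

primrec pure :: "meta \<Rightarrow> bool" where
  "pure (Var n) = True"
| "pure (Lam M) = pure M"
| "pure (App M N) = (pure M \<and> pure N)"
| "pure (TLam M) = pure M"
| "pure (TApp M A) = pure M"
| "pure Star = False"
| "pure (Guard M N) = False"
| "pure (Gen A) = False"
| "pure (Ver A M) = False"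
| "pure (Nu M) = False"

definition beta_normal :: "meta \<Rightarrow> bool" where
  "beta_normal M \<longleftrightarrow> \<not> (\<exists>N. M \<rightarrow>\<^sub>\<beta> N)"

definition is_beta_nf :: "meta \<Rightarrow> meta \<Rightarrow> bool" where
  "is_beta_nf M N \<longleftrightarrow> M \<rightarrow>\<^sub>\<beta>\<^sup>* N \<and> beta_normal N"

definition beta_normalizing :: "meta \<Rightarrow> bool" where
  "beta_normalizing M \<longleftrightarrow> (\<exists>N. is_beta_nf M N)"

definition beta_nf :: "meta \<Rightarrow> meta"  (\<open>_\<down>\<close> [1000] 1000) where
  "M\<down> = (THE N. is_beta_nf M N)"

definition good :: "meta \<Rightarrow> bool" where
  "good M \<longleftrightarrow> pure M \<and> beta_normalizing M"

text \<open>
  An environment is a finite partial map from term variables to types. Extension at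
  \<open>Lam\<close> shifts the other variables by one; passing under \<open>TLam\<close> weakens the types of
  the environment, which expresses that the bound type variable is not free in it.
\<close>

type_synonym env = "nat \<Rightarrow> ty option"

definition is_env :: "env \<Rightarrow> bool" where
  "is_env \<Gamma> \<longleftrightarrow> finite (dom \<Gamma>)"

inductive typing :: "env \<Rightarrow> meta \<Rightarrow> ty \<Rightarrow> bool"  (\<open>_ \<turnstile> _ : _\<close> [50, 50, 50] 50) where
  Var: "\<Gamma> n = Some A \<Longrightarrow> \<Gamma> \<turnstile> Var n : A"
| Lam: "case_nat (Some A) \<Gamma> \<turnstile> M : B \<Longrightarrow> \<Gamma> \<turnstile> Lam M : Arr A B"
| App: "\<Gamma> \<turnstile> M : Arr A B \<Longrightarrow> \<Gamma> \<turnstile> N : A \<Longrightarrow> \<Gamma> \<turnstile> App M N : B"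
| TLam: "map_option ty_tshift \<circ> \<Gamma> \<turnstile> M : A \<Longrightarrow> \<Gamma> \<turnstile> TLam M : All A"
| TApp: "\<Gamma> \<turnstile> M : All A \<Longrightarrow> \<Gamma> \<turnstile> TApp M B : A[0 :=\<^sub>a B]"

text \<open>The metaterm \<open>M\<^sup>\<Gamma>\<close>: variables outside of the domain of \<open>\<Gamma>\<close> are left unchanged.\<close>

definition gen_env :: "env \<Rightarrow> meta \<Rightarrow> meta" where
  "gen_env \<Gamma> = subst (\<lambda>n. case \<Gamma> n of None \<Rightarrow> Var n | Some A \<Rightarrow> Gen A)"

end

theory Submission
  imports Defs
begin

text \<open>
  Reduction is confluent (by parallel reduction), so acceptance, that is, reducibility to \<open>Star\<close>, is
  invariant under reduction, and \<open>M\<close> may be replaced by its normal form \<open>N\<close>. The typing is then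
  read off by induction on \<open>N\<close>. If \<open>N\<close> is an abstraction, expanding \<open>Ver\<close> turns the bound
  variable into a generator or the bound type variable into a fresh eigenvariable, which renaming
  turns back. If \<open>N\<close> is neutral, then under the generators it either reduces to \<open>Gen D\<close> with
  \<open>D\<close> a type of \<open>N\<close>, each argument having been verified by a guard, or it gets stuck and is never
  accepted. Finally, \<open>Ver A (Gen D)\<close> is accepted only if \<open>A = D\<close>.
\<close>

section \<open>Simultaneous substitution\<close>

text \<open>
  A common generalization of the renamings and substitutions of the definitions. Unlike those, it
  can replace eigenvariables by arbitrary types, which is needed to turn an eigenvariable back into
  a type variable.
\<close>

primrec sub_ty :: "(nat \<Rightarrow> ty) \<Rightarrow> (nat \<Rightarrow> ty) \<Rightarrow> ty \<Rightarrow> ty" where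
  "sub_ty \<theta> \<eta> (TVar n) = \<theta> n"
| "sub_ty \<theta> \<eta> (EVar n) = \<eta> n"
| "sub_ty \<theta> \<eta> (Arr A B) = Arr (sub_ty \<theta> \<eta> A) (sub_ty \<theta> \<eta> B)"
| "sub_ty \<theta> \<eta> (All A) = All (sub_ty (case_nat (TVar 0) (ty_tshift \<circ> \<theta>)) (ty_tshift \<circ> \<eta>) A)"

primrec sub :: "(nat \<Rightarrow> ty) \<Rightarrow> (nat \<Rightarrow> ty) \<Rightarrow> (nat \<Rightarrow> meta) \<Rightarrow> meta \<Rightarrow> meta" where
  "sub \<theta> \<eta> \<sigma> (Var n) = \<sigma> n"
| "sub \<theta> \<eta> \<sigma> (Lam M) = Lam (sub \<theta> \<eta> (case_nat (Var 0) (xshift \<circ> \<sigma>)) M)"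
| "sub \<theta> \<eta> \<sigma> (App M N) = App (sub \<theta> \<eta> \<sigma> M) (sub \<theta> \<eta> \<sigma> N)"
| "sub \<theta> \<eta> \<sigma> (TLam M) = TLam (sub (case_nat (TVar 0) (ty_tshift \<circ> \<theta>)) (ty_tshift \<circ> \<eta>) (tshift \<circ> \<sigma>) M)"
| "sub \<theta> \<eta> \<sigma> (TApp M A) = TApp (sub \<theta> \<eta> \<sigma> M) (sub_ty \<theta> \<eta> A)"
| "sub \<theta> \<eta> \<sigma> Star = Star"
| "sub \<theta> \<eta> \<sigma> (Guard M N) = Guard (sub \<theta> \<eta> \<sigma> M) (sub \<theta> \<eta> \<sigma> N)"
| "sub \<theta> \<eta> \<sigma> (Gen A) = Gen (sub_ty \<theta> \<eta> A)"
| "sub \<theta> \<eta> \<sigma> (Ver A M) = Ver (sub_ty \<theta> \<eta> A) (sub \<theta> \<eta> \<sigma> M)"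
| "sub \<theta> \<eta> \<sigma> (Nu M) = Nu (sub (ty_eshift \<circ> \<theta>) (case_nat (EVar 0) (ty_eshift \<circ> \<eta>)) (eshift \<circ> \<sigma>) M)"

section \<open>Fusion laws for renaming and substitution\<close>

lemma lift_ren_simps [simp]:
  "lift_ren \<rho> 0 = 0" "lift_ren \<rho> (Suc n) = Suc (\<rho> n)" "lift_ren id = id"
  by (auto simp: lift_ren_def fun_eq_iff split: nat.splits)

lemma case_nat_lift_ren [simp]:
  "case_nat a (f \<circ> g) \<circ> lift_ren \<rho> = case_nat a (f \<circ> (g \<circ> \<rho>))"
  by (auto simp: lift_ren_def fun_eq_iff split: nat.splits)

lemma sub_ty_cong:
  "(\<And>n. \<theta> n = \<theta>' n) \<Longrightarrow> (\<And>n. \<eta> n = \<eta>' n) \<Longrightarrow> sub_ty \<theta> \<eta> A = sub_ty \<theta>' \<eta>' A"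
  by (metis ext)

lemma sub_cong:
  "(\<And>n. \<theta> n = \<theta>' n) \<Longrightarrow> (\<And>n. \<eta> n = \<eta>' n) \<Longrightarrow> (\<And>n. \<sigma> n = \<sigma>' n) \<Longrightarrow>
    sub \<theta> \<eta> \<sigma> M = sub \<theta>' \<eta>' \<sigma>' M"
  by (metis ext)

text \<open>This and its analogues below express every operation of the definitions through
  \<open>sub_ty\<close> or \<open>sub\<close>, so that one set of composition laws serves all of
  them.\<close>

lemma ren_ty_eq_sub_ty: "ren_ty \<tau> \<epsilon> A = sub_ty (TVar \<circ> \<tau>) (EVar \<circ> \<epsilon>) A"
  by (induction A arbitrary: \<tau> \<epsilon>) (auto intro!: sub_ty_cong split: nat.splits)

lemma subst_ty_eq_sub_ty: "subst_ty \<theta> A = sub_ty \<theta> EVar A"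
  by (induction A arbitrary: \<theta>) (auto intro!: sub_ty_cong split: nat.splits)

text \<open>Passing under a binder composes a substitution with a shift, so the laws involving
  renamings must precede the general one \<open>sub_ty_sub_ty\<close>. The same order recurs for
  metaterms.\<close>

lemma sub_ty_ren_ty: "sub_ty \<theta> \<eta> (ren_ty \<tau> \<epsilon> A) = sub_ty (\<theta> \<circ> \<tau>) (\<eta> \<circ> \<epsilon>) A"
  by (induction A arbitrary: \<theta> \<eta> \<tau> \<epsilon>) (auto simp: comp_assoc)

lemma ren_ty_ren_ty: "ren_ty \<tau> \<epsilon> (ren_ty \<tau>' \<epsilon>' A) = ren_ty (\<tau> \<circ> \<tau>') (\<epsilon> \<circ> \<epsilon>') A"
  by (metis sub_ty_ren_ty ren_ty_eq_sub_ty comp_assoc)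

lemma ren_ty_sub_ty:
  "ren_ty \<tau> \<epsilon> (sub_ty \<theta> \<eta> A) = sub_ty (ren_ty \<tau> \<epsilon> \<circ> \<theta>) (ren_ty \<tau> \<epsilon> \<circ> \<eta>) A"
  by (induction A arbitrary: \<theta> \<eta> \<tau> \<epsilon>)
    (auto intro!: sub_ty_cong simp: ren_ty_ren_ty comp_def split: nat.splits)

lemma sub_ty_sub_ty:
  "sub_ty \<theta> \<eta> (sub_ty \<theta>' \<eta>' A) = sub_ty (sub_ty \<theta> \<eta> \<circ> \<theta>') (sub_ty \<theta> \<eta> \<circ> \<eta>') A"
  by (induction A arbitrary: \<theta> \<eta> \<theta>' \<eta>')
    (auto intro!: sub_ty_cong simp: sub_ty_ren_ty ren_ty_sub_ty comp_def split: nat.splits)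

lemma sub_ty_id [simp]: "sub_ty TVar EVar A = A"
proof -
  \<comment> \<open>The identity is given by equations because its lifting under a binder equals it
    only extensionally.\<close>
  have *: "\<theta> = TVar \<Longrightarrow> \<eta> = EVar \<Longrightarrow> sub_ty \<theta> \<eta> A = A" for \<theta> \<eta>
  proof (induction A arbitrary: \<theta> \<eta>)
    case (All A)
    then show ?case by (auto intro!: All.IH simp: fun_eq_iff split: nat.splits)
  qed auto
  show ?thesis by (rule *) auto
qed

lemma ren_ty_id [simp]: "ren_ty id id A = A"
  by (simp add: ren_ty_eq_sub_ty)

lemma ren_eq_sub: "ren \<xi> \<tau> \<epsilon> M = sub (TVar \<circ> \<tau>) (EVar \<circ> \<epsilon>) (Var \<circ> \<xi>) M"
  by (induction M arbitrary: \<xi> \<tau> \<epsilon>)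
    (auto intro!: sub_cong simp: ren_ty_eq_sub_ty split: nat.splits)

lemma tsubst_eq_sub: "tsubst \<theta> M = sub \<theta> EVar Var M"
  by (induction M arbitrary: \<theta>)
    (auto intro!: sub_cong simp: subst_ty_eq_sub_ty split: nat.splits)

lemma subst_eq_sub: "subst \<sigma> M = sub TVar EVar \<sigma> M"
  by (induction M arbitrary: \<sigma>) (auto intro!: sub_cong split: nat.splits)

lemma sub_ren: "sub \<theta> \<eta> \<sigma> (ren \<xi> \<tau> \<epsilon> M) = sub (\<theta> \<circ> \<tau>) (\<eta> \<circ> \<epsilon>) (\<sigma> \<circ> \<xi>) M"
  by (induction M arbitrary: \<theta> \<eta> \<sigma> \<xi> \<tau> \<epsilon>) (auto simp: comp_assoc sub_ty_ren_ty)

lemma ren_ren: "ren \<xi> \<tau> \<epsilon> (ren \<xi>' \<tau>' \<epsilon>' M) = ren (\<xi> \<circ> \<xi>') (\<tau> \<circ> \<tau>') (\<epsilon> \<circ> \<epsilon>') M"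
  by (metis sub_ren ren_eq_sub comp_assoc)

lemma ren_sub:
  "ren \<xi> \<tau> \<epsilon> (sub \<theta> \<eta> \<sigma> M) = sub (ren_ty \<tau> \<epsilon> \<circ> \<theta>) (ren_ty \<tau> \<epsilon> \<circ> \<eta>) (ren \<xi> \<tau> \<epsilon> \<circ> \<sigma>) M"
  by (induction M arbitrary: \<theta> \<eta> \<sigma> \<xi> \<tau> \<epsilon>)
    (auto intro!: sub_cong simp: ren_ty_sub_ty ren_ty_ren_ty ren_ren comp_def split: nat.splits)

lemma sub_sub:
  "sub \<theta> \<eta> \<sigma> (sub \<theta>' \<eta>' \<sigma>' M) =
    sub (sub_ty \<theta> \<eta> \<circ> \<theta>') (sub_ty \<theta> \<eta> \<circ> \<eta>') (sub \<theta> \<eta> \<sigma> \<circ> \<sigma>') M"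
  by (induction M arbitrary: \<theta> \<eta> \<sigma> \<theta>' \<eta>' \<sigma>')
    (auto intro!: sub_cong simp: sub_ty_sub_ty sub_ty_ren_ty ren_ty_sub_ty sub_ren ren_sub comp_def
      split: nat.splits)

lemma sub_id [simp]: "sub TVar EVar Var M = M"
proof -
  have *: "\<theta> = TVar \<Longrightarrow> \<eta> = EVar \<Longrightarrow> \<sigma> = Var \<Longrightarrow> sub \<theta> \<eta> \<sigma> M = M" for \<theta> \<eta> \<sigma>
  proof (induction M arbitrary: \<theta> \<eta> \<sigma>)
    case (Lam M)
    then show ?case by (auto intro!: Lam.IH simp: fun_eq_iff split: nat.splits)
  next
    case (TLam M)
    then show ?case by (auto intro!: TLam.IH simp: fun_eq_iff split: nat.splits)
  next
    case (Nu M)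
    then show ?case by (auto intro!: Nu.IH simp: fun_eq_iff split: nat.splits)
  qed auto
  show ?thesis by (rule *) auto
qed

lemma ren_id [simp]: "ren id id id M = M"
  by (simp add: ren_eq_sub)

lemmas inst_eq_sub =
  inst_def[unfolded subst_eq_sub] tinst_def[unfolded tsubst_eq_sub] ty_inst_def[unfolded subst_ty_eq_sub_ty]

text \<open>After fusion both sides are a single simultaneous substitution and agree on each
  variable; the next two lemmas hold likewise.\<close>

lemma sub_inst:
  "sub \<theta> \<eta> \<sigma> (M[0 :=\<^sub>x N]) = (sub \<theta> \<eta> (case_nat (Var 0) (xshift \<circ> \<sigma>)) M)[0 :=\<^sub>x sub \<theta> \<eta> \<sigma> N]"
  by (auto intro!: sub_cong simp: inst_eq_sub sub_sub sub_ren comp_def split: nat.splits)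

lemma sub_tinst:
  "sub \<theta> \<eta> \<sigma> (M[0 :=\<^sub>t A]) =
    (sub (case_nat (TVar 0) (ty_tshift \<circ> \<theta>)) (ty_tshift \<circ> \<eta>) (tshift \<circ> \<sigma>) M)[0 :=\<^sub>t sub_ty \<theta> \<eta> A]"
  by (auto intro!: sub_cong simp: inst_eq_sub sub_sub sub_ren sub_ty_ren_ty comp_def split: nat.splits)

lemma sub_ty_inst:
  "sub_ty \<theta> \<eta> (A[0 :=\<^sub>a B]) =
    (sub_ty (case_nat (TVar 0) (ty_tshift \<circ> \<theta>)) (ty_tshift \<circ> \<eta>) A)[0 :=\<^sub>a sub_ty \<theta> \<eta> B]"
  by (auto intro!: sub_ty_cong simp: inst_eq_sub sub_ty_sub_ty sub_ty_ren_ty comp_def split: nat.splits)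

lemma sub_eshift:
  "sub (ty_eshift \<circ> \<theta>) (case_nat (EVar 0) (ty_eshift \<circ> \<eta>)) (eshift \<circ> \<sigma>) (eshift M) =
    eshift (sub \<theta> \<eta> \<sigma> M)"
  by (auto intro!: sub_cong simp: sub_ren ren_sub comp_def)

text \<open>The lifted substitution fixes the eigenvariable introduced by \<open>ver_all\<close>,
  hence it commutes with that expansion.\<close>

lemma sub_ty_ver_all:
  "sub_ty (ty_eshift \<circ> \<theta>) (case_nat (EVar 0) (ty_eshift \<circ> \<eta>)) ((ty_eshift A)[0 :=\<^sub>a EVar 0]) =
    (ty_eshift (sub_ty (case_nat (TVar 0) (ty_tshift \<circ> \<theta>)) (ty_tshift \<circ> \<eta>) A))[0 :=\<^sub>a EVar 0]"
  by (auto intro!: sub_ty_cong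
      simp: inst_eq_sub sub_ty_sub_ty ren_ty_sub_ty sub_ty_ren_ty ren_ty_ren_ty comp_def
      split: nat.splits)
    (simp_all add: ren_ty_eq_sub_ty comp_def)

section \<open>Confluence\<close>

text \<open>Parallel reduction in the style of Tait and Martin-Loef: nested redexes are contracted
  in one step so that the diamond property holds.\<close>

inductive par :: "meta \<Rightarrow> meta \<Rightarrow> bool" where
  Var: "par (Var n) (Var n)"
| Lam: "par M M' \<Longrightarrow> par (Lam M) (Lam M')"
| App: "par M M' \<Longrightarrow> par N N' \<Longrightarrow> par (App M N) (App M' N')"
| TLam: "par M M' \<Longrightarrow> par (TLam M) (TLam M')"
| TApp: "par M M' \<Longrightarrow> par (TApp M A) (TApp M' A)"
| Star: "par Star Star"
| Guard: "par M M' \<Longrightarrow> par N N' \<Longrightarrow> par (Guard M N) (Guard M' N')"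
| Gen: "par (Gen A) (Gen A)"
| Ver: "par M M' \<Longrightarrow> par (Ver A M) (Ver A M')"
| Nu: "par M M' \<Longrightarrow> par (Nu M) (Nu M')"
| beta: "par M M' \<Longrightarrow> par N N' \<Longrightarrow> par (App (Lam M) N) (M'[0 :=\<^sub>x N'])"
| tbeta: "par M M' \<Longrightarrow> par (TApp (TLam M) A) (M'[0 :=\<^sub>t A])"
| guard: "par M M' \<Longrightarrow> par (Guard Star M) M'"
| ver_gen: "par (Ver (EVar n) (Gen (EVar n))) Star"
| gen_arr: "par (Gen (Arr A B)) (Lam (Guard (Ver A (Var 0)) (Gen B)))"
| ver_arr: "par M M' \<Longrightarrow> par (Ver (Arr A B) M) (Ver B (App M' (Gen A)))"
| gen_all: "par (Gen (All A)) (TLam (Gen A))"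
| ver_all: "par M M' \<Longrightarrow> par (Ver (All A) M)
     (Nu (Ver ((ty_eshift A)[0 :=\<^sub>a EVar 0]) (TApp (eshift M') (EVar 0))))"
| nu_gc: "par M M' \<Longrightarrow> par (Nu (eshift M)) M'"

lemma par_refl [simp]: "par M M"
  by (induction M) (auto intro: par.intros)

lemma red_imp_par: "M \<rightarrow>\<^sub>m N \<Longrightarrow> par M N"
  by (induction rule: ctxt_closure.induct) (auto elim!: red_root.cases intro: par.intros)

inductive_cases par_VarE [elim!]: "par (Var n) N"
inductive_cases par_LamE [elim!]: "par (Lam M) N"
inductive_cases par_TLamE [elim!]: "par (TLam M) N"
inductive_cases par_StarE [elim!]: "par Star N"
inductive_cases par_AppE: "par (App M N) P"
inductive_cases par_TAppE: "par (TApp M A) P"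
inductive_cases par_GuardE: "par (Guard M N) P"
inductive_cases par_GenE: "par (Gen A) P"
inductive_cases par_VerE: "par (Ver A M) P"
inductive_cases par_NuE: "par (Nu M) P"

text \<open>Quantifying over renamings makes the condition stable under the shifts at binders before
  \<open>par_ren\<close> is available, which itself comes out of \<open>par_sub_aux\<close>.
  Eigenvariables must go to eigenvariables because \<open>ver_gen\<close> fires on nothing
  else.\<close>

definition par_substs :: "(nat \<Rightarrow> ty) \<Rightarrow> (nat \<Rightarrow> meta) \<Rightarrow> (nat \<Rightarrow> meta) \<Rightarrow> bool" where
  "par_substs \<eta> \<sigma> \<sigma>' \<longleftrightarrow> (\<forall>n. \<exists>k. \<eta> n = EVar k) \<and>
    (\<forall>n \<xi> \<tau> \<epsilon>. par (ren \<xi> \<tau> \<epsilon> (\<sigma> n)) (ren \<xi> \<tau> \<epsilon> (\<sigma>' n)))"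

lemma par_substs_lift:
  assumes "par_substs \<eta> \<sigma> \<sigma>'"
  shows "par_substs \<eta> (case_nat (Var 0) (xshift \<circ> \<sigma>)) (case_nat (Var 0) (xshift \<circ> \<sigma>'))"
    and "par_substs (ty_tshift \<circ> \<eta>) (tshift \<circ> \<sigma>) (tshift \<circ> \<sigma>')"
    and "par_substs (case_nat (EVar 0) (ty_eshift \<circ> \<eta>)) (eshift \<circ> \<sigma>) (eshift \<circ> \<sigma>')"
  using assms
  by (auto simp: par_substs_def ren_ren comp_def split: nat.splits)
    (metis ren_ty.simps(2))+

lemma par_sub_aux:
  assumes "par M M'" and "par_substs \<eta> \<sigma> \<sigma>'"
  shows "par (sub \<theta> \<eta> \<sigma> M) (sub \<theta> \<eta> \<sigma>' M')"
  using assms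
proof (induction arbitrary: \<theta> \<eta> \<sigma> \<sigma>' rule: par.induct)
  case (Var n)
  then have "par (ren id id id (\<sigma> n)) (ren id id id (\<sigma>' n))"
    unfolding par_substs_def by blast
  then show ?case by simp
next
  case (ver_gen n)
  then obtain k where "\<eta> n = EVar k" unfolding par_substs_def by blast
  then show ?case by (simp add: par.ver_gen)
next
  case (ver_all M M' A)
  then show ?case by (simp add: sub_ty_ver_all sub_eshift par.ver_all)
next
  case (Lam M M')
  show ?case using Lam.IH[OF par_substs_lift(1)[OF Lam.prems]] unfolding sub.simps by (rule par.Lam)
next
  case (TLam M M')
  show ?case using TLam.IH[OF par_substs_lift(2)[OF TLam.prems]] unfolding sub.simps by (rule par.TLam)
next
  case (Nu M M')
  show ?case using Nu.IH[OF par_substs_lift(3)[OF Nu.prems]] unfolding sub.simps by (rule par.Nu)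
next
  case (beta M M' N N')
  show ?case
    using beta.IH(1)[OF par_substs_lift(1)[OF beta.prems]] beta.IH(2)[OF beta.prems]
    by (simp add: sub_inst par.beta)
next
  case (tbeta M M' A)
  show ?case
    using tbeta.IH[OF par_substs_lift(2)[OF tbeta.prems]] unfolding sub.simps sub_tinst by (rule par.tbeta)
qed (auto simp: sub_eshift intro!: par.intros)

lemma par_ren: "par M M' \<Longrightarrow> par (ren \<xi> \<tau> \<epsilon> M) (ren \<xi> \<tau> \<epsilon> M')"
  unfolding ren_eq_sub by (rule par_sub_aux) (auto simp: par_substs_def)

lemma par_inst: "par M M' \<Longrightarrow> par N N' \<Longrightarrow> par (M[0 :=\<^sub>x N]) (M'[0 :=\<^sub>x N'])"
  unfolding inst_eq_sub
  by (rule par_sub_aux) (auto simp: par_substs_def par_ren split: nat.splits)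

lemma par_tinst: "par M M' \<Longrightarrow> par (M[0 :=\<^sub>t A]) (M'[0 :=\<^sub>t A])"
  unfolding inst_eq_sub by (rule par_sub_aux) (auto simp: par_substs_def)

lemma par_subst: "par M M' \<Longrightarrow> par (subst \<sigma> M) (subst \<sigma> M')"
  unfolding subst_eq_sub by (rule par_sub_aux) (auto simp: par_substs_def)

section \<open>Weakening by a fresh eigenvariable\<close>

lemma ren_inst:
  "ren \<xi> \<tau> \<epsilon> (M[0 :=\<^sub>x N]) = (ren (lift_ren \<xi>) \<tau> \<epsilon> M)[0 :=\<^sub>x ren \<xi> \<tau> \<epsilon> N]"
  by (auto intro!: sub_cong simp: inst_eq_sub ren_sub sub_ren split: nat.splits)

lemma ren_tinst:
  "ren \<xi> \<tau> \<epsilon> (M[0 :=\<^sub>t A]) = (ren \<xi> (lift_ren \<tau>) \<epsilon> M)[0 :=\<^sub>t ren_ty \<tau> \<epsilon> A]"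
  by (auto intro!: sub_cong simp: inst_eq_sub ren_sub sub_ren split: nat.splits)

lemma ren_ty_inst:
  "ren_ty \<tau> \<epsilon> (A[0 :=\<^sub>a B]) = (ren_ty (lift_ren \<tau>) \<epsilon> A)[0 :=\<^sub>a ren_ty \<tau> \<epsilon> B]"
  by (auto intro!: sub_ty_cong simp: inst_eq_sub ren_ty_sub_ty sub_ty_ren_ty split: nat.splits)

lemma lift_ren_comp_Suc: "lift_ren \<rho> \<circ> Suc = Suc \<circ> \<rho>"
  by auto

lemma ren_eshift: "ren \<xi> \<tau> (lift_ren \<epsilon>) (eshift M) = eshift (ren \<xi> \<tau> \<epsilon> M)"
  by (simp add: ren_ren lift_ren_comp_Suc)

lemma ren_ty_eshift: "ren_ty \<tau> (lift_ren \<epsilon>) (ty_eshift A) = ty_eshift (ren_ty \<tau> \<epsilon> A)"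
  by (simp add: ren_ty_ren_ty lift_ren_comp_Suc)

definition edrop :: "meta \<Rightarrow> meta" where
  "edrop = ren id id (\<lambda>n. n - 1)"

lemma edrop_eshift [simp]: "edrop (eshift M) = M"
proof -
  have "(\<lambda>n. n - 1) \<circ> Suc = id" by auto
  then show ?thesis by (simp add: edrop_def ren_ren)
qed

lemma edrop_Star [simp]: "edrop Star = Star"
  by (simp add: edrop_def)

lemma eshift_inject [simp]: "eshift M = eshift N \<longleftrightarrow> M = N"
  by (metis edrop_eshift)

text \<open>
  With \<open>\<delta>\<close> moving only \<open>0\<close>, being fixed by \<open>\<delta>\<close> means not containing the eigenvariable
  \<open>0\<close>, so reduction creates no eigenvariables.
\<close>

lemma par_fixed:
  assumes "par M N" and "ren id id \<delta> M = M"
  shows "ren id id \<delta> N = N"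
  using assms
  by (induction arbitrary: \<delta> rule: par.induct)
    (auto simp: ren_inst ren_tinst ren_ty_inst ren_eshift ren_ty_eshift)

text \<open>Absence of eigenvariable \<open>0\<close> persists by \<open>par_fixed\<close>, so the
  reduct is a weakening too. This resolves the overlap of \<open>nu_gc\<close> with steps inside the
  body.\<close>

lemma par_eshiftE:
  assumes "par (eshift M) N"
  obtains N' where "N = eshift N'" and "par M N'"
proof -
  \<comment> \<open>Truncated subtraction makes \<delta> send \<open>0\<close> to \<open>1\<close>
    and fix all other indices.\<close>
  define \<delta> :: "nat \<Rightarrow> nat" where "\<delta> n = Suc (n - 1)" for n
  have "\<delta> \<circ> Suc = Suc" and d: "\<delta> = Suc \<circ> (\<lambda>n. n - 1)" by (auto simp: \<delta>_def)
  then have "ren id id \<delta> (eshift M) = eshift M" by (simp add: ren_ren)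
  then have "ren id id \<delta> N = N" by (rule par_fixed[OF assms])
  then have "N = eshift (edrop N)" by (simp add: edrop_def ren_ren d)
  moreover have "par M (edrop N)"
    using par_ren[OF assms, of id id "\<lambda>n. n - 1"] unfolding edrop_def[symmetric] by simp
  ultimately show thesis by (rule that)
qed

text \<open>A root contraction overlaps only with steps inside the parts of its redex. For each
  redex the reducts are listed, the parts are joined by induction, and the contraction is performed
  where it is still missing.\<close>

lemma par_diamond: "par M N1 \<Longrightarrow> par M N2 \<Longrightarrow> \<exists>P. par N1 P \<and> par N2 P"
proof (induction M arbitrary: N1 N2)
  case (Lam M)
  then show ?case by (blast intro: par.Lam)
next
  case (TLam M)
  then show ?case by (blast intro: par.TLam)
next
  case (App M N)
  show ?case
  proof (cases "\<exists>L. M = Lam L")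
    case True
    then obtain L where M: "M = Lam L" by blast
    have *: "\<exists>L' N'. par L L' \<and> par N N' \<and> (X = App (Lam L') N' \<or> X = L'[0 :=\<^sub>x N'])"
      if "par (App M N) X" for X
      using that M by (auto elim!: par_AppE)
    obtain L1 Q1 where 1: "par L L1" "par N Q1" "N1 = App (Lam L1) Q1 \<or> N1 = L1[0 :=\<^sub>x Q1]"
      using *[OF App.prems(1)] by blast
    obtain L2 Q2 where 2: "par L L2" "par N Q2" "N2 = App (Lam L2) Q2 \<or> N2 = L2[0 :=\<^sub>x Q2]"
      using *[OF App.prems(2)] by blast
    \<comment> \<open>The hypothesis concerns \<open>Lam L\<close>; the common reduct of the two
      abstractions is inverted to obtain one for the bodies.\<close>
    obtain P where P: "par L1 P" "par L2 P"
      using App.IH(1)[of "Lam L1" "Lam L2"] 1(1) 2(1) M par.Lam by blast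
    obtain Q where Q: "par Q1 Q" "par Q2 Q"
      using App.IH(2)[OF 1(2) 2(2)] by blast
    have "par N1 (P[0 :=\<^sub>x Q])" "par N2 (P[0 :=\<^sub>x Q])"
      using 1(3) 2(3) P Q by (auto intro: par.beta par_inst)
    then show ?thesis by blast
  next
    case False
    then obtain M1 Q1 M2 Q2 where "N1 = App M1 Q1" "par M M1" "par N Q1"
        "N2 = App M2 Q2" "par M M2" "par N Q2"
      using App.prems by (auto elim!: par_AppE)
    then show ?thesis using App.IH by (meson par.App)
  qed
next
  case (TApp M A)
  show ?case
  proof (cases "\<exists>L. M = TLam L")
    case True
    then obtain L where M: "M = TLam L" by blast
    have *: "\<exists>L'. par L L' \<and> (X = TApp (TLam L') A \<or> X = L'[0 :=\<^sub>t A])"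
      if "par (TApp M A) X" for X
      using that M by (auto elim!: par_TAppE)
    obtain L1 where 1: "par L L1" "N1 = TApp (TLam L1) A \<or> N1 = L1[0 :=\<^sub>t A]"
      using *[OF TApp.prems(1)] by blast
    obtain L2 where 2: "par L L2" "N2 = TApp (TLam L2) A \<or> N2 = L2[0 :=\<^sub>t A]"
      using *[OF TApp.prems(2)] by blast
    obtain P where P: "par L1 P" "par L2 P"
      using TApp.IH[of "TLam L1" "TLam L2"] 1(1) 2(1) M par.TLam by blast
    have "par N1 (P[0 :=\<^sub>t A])" "par N2 (P[0 :=\<^sub>t A])"
      using 1(2) 2(2) P by (auto intro: par.tbeta par_tinst)
    then show ?thesis by blast
  next
    case False
    then obtain M1 M2 where "N1 = TApp M1 A" "par M M1" "N2 = TApp M2 A" "par M M2"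
      using TApp.prems by (auto elim!: par_TAppE)
    then show ?thesis using TApp.IH by (meson par.TApp)
  qed
next
  case (Guard M N)
  show ?case
  proof (cases "M = Star")
    case True
    have *: "\<exists>N'. par N N' \<and> (X = Guard Star N' \<or> X = N')" if "par (Guard M N) X" for X
      using that True by (auto elim!: par_GuardE)
    obtain Q1 where 1: "par N Q1" "N1 = Guard Star Q1 \<or> N1 = Q1"
      using *[OF Guard.prems(1)] by blast
    obtain Q2 where 2: "par N Q2" "N2 = Guard Star Q2 \<or> N2 = Q2"
      using *[OF Guard.prems(2)] by blast
    obtain Q where "par Q1 Q" "par Q2 Q"
      using Guard.IH(2)[OF 1(1) 2(1)] by blast
    then have "par N1 Q" "par N2 Q" using 1(2) 2(2) by (auto intro: par.guard)
    then show ?thesis by blast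
  next
    case False
    then obtain M1 Q1 M2 Q2 where "N1 = Guard M1 Q1" "par M M1" "par N Q1"
        "N2 = Guard M2 Q2" "par M M2" "par N Q2"
      using Guard.prems by (auto elim!: par_GuardE)
    then show ?thesis using Guard.IH by (meson par.Guard)
  qed
next
  case (Gen A)
  then show ?case by (auto elim!: par_GenE intro: par_refl par.intros)
next
  case (Ver A M)
  show ?case
  proof (cases "\<exists>n. A = EVar n \<and> M = Gen (EVar n)")
    case True
    then have "par N1 Star" "par N2 Star"
      using Ver.prems by (auto elim!: par_VerE par_GenE intro: par.intros)
    then show ?thesis by blast
  next
    case False
    \<comment> \<open>\<open>exp\<close> is the expansion prescribed by the type and does nothing at
      atoms, so all cases other than \<open>ver_gen\<close> are joined uniformly.\<close>
    define exp where "exp M = (case A of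
        Arr A B \<Rightarrow> Ver B (App M (Gen A))
      | All A \<Rightarrow> Nu (Ver ((ty_eshift A)[0 :=\<^sub>a EVar 0]) (TApp (eshift M) (EVar 0)))
      | _ \<Rightarrow> Ver A M)" for M
    have exp: "par (Ver A M) (exp M')" "par (exp M) (exp M')" if "par M M'" for M M'
      using that by (auto simp: exp_def split: ty.splits intro!: par.intros par_ren)
    have *: "\<exists>M'. par M M' \<and> (X = Ver A M' \<or> X = exp M')" if "par (Ver A M) X" for X
      using that False by (auto simp: exp_def elim!: par_VerE)
    obtain M1 where 1: "par M M1" "N1 = Ver A M1 \<or> N1 = exp M1"
      using *[OF Ver.prems(1)] by blast
    obtain M2 where 2: "par M M2" "N2 = Ver A M2 \<or> N2 = exp M2"
      using *[OF Ver.prems(2)] by blast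
    obtain P where "par M1 P" "par M2 P"
      using Ver.IH[OF 1(1) 2(1)] by blast
    then have "par N1 (exp P)" "par N2 (exp P)" using 1(2) 2(2) by (auto intro: exp)
    then show ?thesis by blast
  qed
next
  case (Nu M)
  show ?case
  proof (cases "\<exists>L. M = eshift L")
    case True
    then obtain L where M: "M = eshift L" by blast
    \<comment> \<open>By \<open>par_eshiftE\<close>, steps inside the body keep it a weakening, so
      \<open>nu_gc\<close> remains applicable.\<close>
    have *: "\<exists>L'. par M (eshift L') \<and> (X = Nu (eshift L') \<or> X = L')" if "par (Nu M) X" for X
      using that
    proof (cases rule: par_NuE[consumes 1, case_names Nu nu_gc])
      case (Nu M')
      then show ?thesis using M par_eshiftE by metis
    next
      case (nu_gc L')
      then show ?thesis using par_ren by blast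
    qed
    obtain L1 where 1: "par M (eshift L1)" "N1 = Nu (eshift L1) \<or> N1 = L1"
      using *[OF Nu.prems(1)] by blast
    obtain L2 where 2: "par M (eshift L2)" "N2 = Nu (eshift L2) \<or> N2 = L2"
      using *[OF Nu.prems(2)] by blast
    obtain P where P: "par (eshift L1) P" "par (eshift L2) P"
      using Nu.IH[OF 1(1) 2(1)] by blast
    then obtain P' where "par L1 P'" "par L2 P'"
      by (metis par_eshiftE eshift_inject)
    then have "par N1 P'" "par N2 P'" using 1(2) 2(2) by (auto intro: par.nu_gc)
    then show ?thesis by blast
  next
    case False
    then obtain M1 M2 where "N1 = Nu M1" "par M M1" "N2 = Nu M2" "par M M2"
      using Nu.prems by (auto elim!: par_NuE)
    then show ?thesis using Nu.IH by (meson par.Nu)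
  qed
qed (auto intro: par_refl)

text \<open>The diamond property carries a step from the source along the path to \<open>N\<close>,
  where it ends in \<open>N\<close> itself; repeating this for each step towards \<open>P\<close>
  gives confluence towards a normal form.\<close>

lemma par_nf_unique:
  assumes "par\<^sup>*\<^sup>* M N" and "\<And>X. par N X \<Longrightarrow> X = N" and "par\<^sup>*\<^sup>* M P"
  shows "par\<^sup>*\<^sup>* P N"
proof -
  have step: "par\<^sup>*\<^sup>* M N \<Longrightarrow> par M P \<Longrightarrow> par\<^sup>*\<^sup>* P N" for M P
  proof (induction arbitrary: P rule: converse_rtranclp_induct)
    case base
    then show ?case using assms(2) by blast
  next
    case (step X Y)
    then show ?case by (meson par_diamond converse_rtranclp_into_rtranclp)
  qed
  show ?thesis
    using assms(3,1) by (induction rule: rtranclp_induct) (auto dest: step)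
qed

section \<open>Acceptance\<close>

abbreviation accepted :: "meta \<Rightarrow> bool" where
  "accepted M \<equiv> par\<^sup>*\<^sup>* M Star"

lemma accepted_par: "accepted M \<Longrightarrow> par\<^sup>*\<^sup>* M N \<Longrightarrow> accepted N"
  by (rule par_nf_unique) auto

lemma par_relpow_ren:
  "(par ^^ k) M N \<Longrightarrow> (par ^^ k) (ren \<xi> \<tau> \<epsilon> M) (ren \<xi> \<tau> \<epsilon> N)"
  by (induction k arbitrary: N) (auto intro: par_ren)

text \<open>If the binder is collected, the remaining steps are replayed on the weakened metaterm,
  and \<open>Star\<close> is its own weakening. The step count is kept for the induction in
  \<open>inert_not_accepted\<close>.\<close>

lemma accepted_Nu: "(par ^^ k) (Nu M) Star \<Longrightarrow> (par ^^ k) M Star"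
proof (induction k arbitrary: M)
  case (Suc k)
  then obtain Y where Y: "par (Nu M) Y" "(par ^^ k) Y Star"
    by (meson relpowp_Suc_D2)
  from Y(1) consider (Nu) M' where "Y = Nu M'" "par M M'" | (nu_gc) L where "M = eshift L" "par L Y"
    by (auto elim!: par_NuE)
  then show ?case
  proof cases
    case Nu
    then show ?thesis using Suc.IH Y(2) by (metis relpowp_Suc_I2)
  next
    case nu_gc
    have "(par ^^ k) (eshift Y) Star" using par_relpow_ren[OF Y(2), of id id Suc] by simp
    moreover have "par M (eshift Y)" using nu_gc by (simp add: par_ren)
    ultimately show ?thesis by (metis relpowp_Suc_I2)
  qed
qed auto

text \<open>Metaterms stuck at the head, which no verifier accepts.\<close>

inductive inert :: "meta \<Rightarrow> bool" where
  Var: "inert (Var n)"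
| TApp_Lam: "inert (TApp (Lam M) A)"
| App_TLam: "inert (App (TLam M) N)"
| App_Gen: "\<nexists>B C. A = Arr B C \<Longrightarrow> inert (App (Gen A) N)"
| TApp_Gen: "\<nexists>B. A = All B \<Longrightarrow> inert (TApp (Gen A) C)"
| Guard: "\<not> accepted M \<Longrightarrow> inert (Guard M N)"
| App: "inert M \<Longrightarrow> inert (App M N)"
| TApp: "inert M \<Longrightarrow> inert (TApp M A)"

lemma not_inert [simp]: "\<not> inert (Lam M)" "\<not> inert (TLam M)" "\<not> inert (Gen A)"
  by (auto elim: inert.cases)

text \<open>An inert head is no abstraction, so no redex arises above it. A guard cannot become
  accepted by reducing, and a generator of the wrong shape can unfold only into the wrong kind of
  abstraction.\<close>

lemma inert_par: "inert M \<Longrightarrow> par M N \<Longrightarrow> inert N"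
proof (induction arbitrary: N rule: inert.induct)
  case (Guard M N')
  then show ?case
    by (auto elim!: par_GuardE intro!: inert.Guard intro: converse_rtranclp_into_rtranclp)
next
  case (App M N')
  from App.prems App.hyps App.IH show ?case
    by cases (auto intro: inert.App)
next
  case (TApp M A)
  from TApp.prems TApp.hyps TApp.IH show ?case
    by cases (auto intro: inert.TApp)
next
  case (App_Gen A N')
  from App_Gen.prems App_Gen.hyps show ?case
    by cases (auto elim!: par_GenE intro: inert.intros)
next
  case (TApp_Gen A C)
  from TApp_Gen.prems TApp_Gen.hyps show ?case
    by cases (auto elim!: par_GenE intro: inert.intros)
qed (auto elim!: par_AppE par_TAppE intro: inert.intros)

lemma inert_eshift: "inert M \<Longrightarrow> inert (eshift M)"
proof (induction rule: inert.induct)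
  case (Guard M N)
  \<comment> \<open>Lowering the indices would turn an acceptance of the weakened guard into one of
    the guard itself.\<close>
  have "\<not> accepted (eshift M)"
  proof
    assume "accepted (eshift M)"
    then obtain k where "(par ^^ k) (eshift M) Star" by (auto simp: rtranclp_power)
    then have "(par ^^ k) (edrop (eshift M)) (edrop Star)"
      unfolding edrop_def by (rule par_relpow_ren)
    with Guard show False by (auto simp: rtranclp_power)
  qed
  then show ?case unfolding ren.simps by (rule inert.Guard)
next
  case (App_Gen A N)
  then show ?case by (cases A) (auto intro: inert.intros)
next
  case (TApp_Gen A C)
  then show ?case by (cases A) (auto intro: inert.intros)
qed (auto intro: inert.intros)

text \<open>Each expansion of \<open>Ver\<close> applies the inert metaterm to one more argument and
  leaves it inert, whereas \<open>ver_gen\<close> would require a generator. The induction is on the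
  number of steps, which removing \<open>Nu\<close> does not increase.\<close>

lemma inert_not_accepted: "inert M \<Longrightarrow> \<not> accepted (Ver A M)"
proof
  have "inert M \<Longrightarrow> \<not> (par ^^ k) (Ver A M) Star" for k
  proof (induction k arbitrary: A M)
    case (Suc k)
    show ?case
    proof
      assume "(par ^^ Suc k) (Ver A M) Star"
      then obtain Y where Y: "par (Ver A M) Y" "(par ^^ k) Y Star"
        by (meson relpowp_Suc_D2)
      from Y(1) consider (Ver) M' where "Y = Ver A M'" "par M M'"
        | (ver_gen) n where "M = Gen (EVar n)"
        | (ver_arr) M' B C where "Y = Ver C (App M' (Gen B))" "par M M'"
        | (ver_all) M' B where "Y = Nu (Ver B (TApp (eshift M') (EVar 0)))" "par M M'"
        by (auto elim!: par_VerE)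
      then show False
      proof cases
        case Ver
        then show ?thesis using Suc Y(2) inert_par by blast
      next
        case ver_gen
        then show ?thesis using Suc.prems by auto
      next
        case ver_arr
        then show ?thesis using Suc Y(2) inert_par inert.App by blast
      next
        case ver_all
        then have "inert (TApp (eshift M') (EVar 0))"
          using Suc.prems inert_par inert.TApp inert_eshift by blast
        then show ?thesis using Suc.IH ver_all(1) Y(2) accepted_Nu by blast
      qed
    qed
  qed auto
  then show "inert M \<Longrightarrow> accepted (Ver A M) \<Longrightarrow> False" by (auto simp: rtranclp_power)
qed

section \<open>Reducing verifiers and generators\<close>

lemma pars_congs:
  assumes "par\<^sup>*\<^sup>* M M'"
  shows "par\<^sup>*\<^sup>* (Ver A M) (Ver A M')" and "par\<^sup>*\<^sup>* (App M N) (App M' N)"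
    and "par\<^sup>*\<^sup>* (TApp M A) (TApp M' A)" and "par\<^sup>*\<^sup>* (Guard M N) (Guard M' N)"
proof -
  have cong: "par\<^sup>*\<^sup>* (f M) (f M')" if "\<And>X Y. par X Y \<Longrightarrow> par (f X) (f Y)" for f
    using assms by (induction rule: rtranclp_induct) (auto intro: rtranclp.rtrancl_into_rtrancl that)
  show "par\<^sup>*\<^sup>* (Ver A M) (Ver A M')" by (rule cong) (rule par.Ver)
  show "par\<^sup>*\<^sup>* (App M N) (App M' N)" by (rule cong) (rule par.App[OF _ par_refl])
  show "par\<^sup>*\<^sup>* (TApp M A) (TApp M' A)" by (rule cong) (rule par.TApp)
  show "par\<^sup>*\<^sup>* (Guard M N) (Guard M' N)" by (rule cong) (rule par.Guard[OF _ par_refl])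
qed

text \<open>At an atom no expansion applies, so only \<open>ver_gen\<close> can produce
  \<open>Star\<close>.\<close>

lemma accepted_Ver_atom:
  assumes "accepted (Ver A M)" and "\<nexists>B C. A = Arr B C" and "\<nexists>B. A = All B"
  obtains n where "A = EVar n" and "par\<^sup>*\<^sup>* M (Gen A)"
proof -
  have "\<exists>n. A = EVar n \<and> par\<^sup>*\<^sup>* M (Gen A)"
    using assms(1)
  proof (induction "Ver A M" arbitrary: M rule: converse_rtranclp_induct)
    case (step Y)
    from step.hyps(1) assms(2,3) show ?case
      by (elim par_VerE) (auto dest: step.hyps(3) intro: converse_rtranclp_into_rtranclp)
  qed
  with that show thesis by blast
qed

lemma pars_value:
  "par\<^sup>*\<^sup>* M N \<Longrightarrow> (\<exists>L. M = Lam L) \<Longrightarrow> \<exists>L. N = Lam L"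
  "par\<^sup>*\<^sup>* M N \<Longrightarrow> (\<exists>L. M = TLam L) \<Longrightarrow> \<exists>L. N = TLam L"
  by (induction rule: rtranclp_induct) auto

text \<open>A generator that unfolds becomes an abstraction of one of the two kinds, and it stays
  one.\<close>

lemma pars_Gen_Gen:
  assumes "par\<^sup>*\<^sup>* (Gen D) (Gen A)"
  shows "D = A"
proof -
  have "N = Gen D \<or> (\<exists>L. N = Lam L) \<or> (\<exists>L. N = TLam L)" if "par\<^sup>*\<^sup>* (Gen D) N" for N
    using that by (induction rule: rtranclp_induct) (auto elim!: par_GenE)
  with assms show ?thesis by blast
qed

lemma pars_App_Gen:
  "par\<^sup>*\<^sup>* (App (Gen (Arr D1 D2)) N) (Guard (Ver D1 N) (Gen D2))"
proof -
  have "par (App (Gen (Arr D1 D2)) N) (App (Lam (Guard (Ver D1 (Var 0)) (Gen D2))) N)"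
    by (intro par.App par.gen_arr par_refl)
  moreover have "par (App (Lam (Guard (Ver D1 (Var 0)) (Gen D2))) N) (Guard (Ver D1 N) (Gen D2))"
    using par.beta[OF par_refl par_refl, of "Guard (Ver D1 (Var 0)) (Gen D2)" N]
    by (simp add: inst_def)
  ultimately show ?thesis by (meson converse_rtranclp_into_rtranclp r_into_rtranclp)
qed

lemma pars_TApp_Gen: "par\<^sup>*\<^sup>* (TApp (Gen (All D)) B) (Gen (D[0 :=\<^sub>a B]))"
proof -
  have "par (TApp (Gen (All D)) B) (TApp (TLam (Gen D)) B)"
    by (intro par.TApp par.gen_all)
  moreover have "par (TApp (TLam (Gen D)) B) (Gen (D[0 :=\<^sub>a B]))"
    using par.tbeta[OF par_refl, of "Gen D" B] by (simp add: tinst_def ty_inst_def)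
  ultimately show ?thesis by (meson converse_rtranclp_into_rtranclp r_into_rtranclp)
qed

lemma pars_Guard_accepted: "accepted M \<Longrightarrow> par\<^sup>*\<^sup>* (Guard M N) N"
  using pars_congs(4) par.guard[OF par_refl] by (meson rtranclp.rtrancl_into_rtrancl)

lemma accepted_Ver_pars: "accepted (Ver A M) \<Longrightarrow> par\<^sup>*\<^sup>* M N \<Longrightarrow> accepted (Ver A N)"
  by (rule accepted_par[OF _ pars_congs(1)])

text \<open>By confluence an accepted verifier may be expanded at once, whatever the accepting
  reduction did first.\<close>

lemma accepted_Ver_Arr: "accepted (Ver (Arr A B) M) \<Longrightarrow> accepted (Ver B (App M (Gen A)))"
  by (rule accepted_par[OF _ r_into_rtranclp[where r = par]]) (auto intro: par.ver_arr)

text \<open>Under the eigenvariable binder, the bound type variable of \<open>All\<close> becomes the eigenvariable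
  \<open>0\<close>. This relabelling of atoms is a bijection.\<close>

abbreviation open_ty :: "ty \<Rightarrow> ty" where
  "open_ty A \<equiv> (ty_eshift A)[0 :=\<^sub>a EVar 0]"

lemma open_ty_eq_sub_ty: "open_ty A = sub_ty (case_nat (EVar 0) TVar) (EVar \<circ> Suc) A"
  by (auto simp: inst_eq_sub sub_ty_ren_ty)

definition close_ty :: "ty \<Rightarrow> ty" where
  "close_ty = sub_ty (TVar \<circ> Suc) (case_nat (TVar 0) EVar)"

lemma close_open_ty: "close_ty (open_ty A) = A"
proof -
  have "close_ty (open_ty A) = sub_ty TVar EVar A"
    unfolding close_ty_def open_ty_eq_sub_ty sub_ty_sub_ty
    by (rule sub_ty_cong) (auto split: nat.splits)
  then show ?thesis by simp
qed

lemma size_open_ty: "size (open_ty A) = size A"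
proof -
  have "size (sub_ty \<theta> \<eta> A) = size A" if "\<And>n. size (\<theta> n) = 0" "\<And>n. size (\<eta> n) = 0" for \<theta> \<eta>
    using that
  proof (induction A arbitrary: \<theta> \<eta>)
    case (All A)
    have "size (ren_ty \<tau> \<epsilon> C) = size C" for \<tau> \<epsilon> C
      by (induction C arbitrary: \<tau> \<epsilon>) auto
    with All show ?case by (auto split: nat.splits)
  qed auto
  then show ?thesis unfolding open_ty_eq_sub_ty by (auto split: nat.splits)
qed

lemma accepted_Ver_All:
  assumes "accepted (Ver (All A) M)"
  shows "accepted (Ver (open_ty A) (TApp (eshift M) (EVar 0)))"
proof -
  have "accepted (Nu (Ver (open_ty A) (TApp (eshift M) (EVar 0))))"
    using assms by (rule accepted_par) (simp add: par.ver_all r_into_rtranclp)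
  then show ?thesis unfolding rtranclp_power using accepted_Nu by blast
qed

text \<open>Expanding \<open>Ver\<close> forces \<open>Gen D\<close> to take an argument, and a
  \<open>D\<close> of another shape would make the result inert; the components are then compared by
  induction.\<close>

lemma accepted_Gen: "accepted (Ver A (Gen D)) \<Longrightarrow> A = D"
proof (induction "size A + size D" arbitrary: A D rule: less_induct)
  case less
  consider (Arr) A1 A2 where "A = Arr A1 A2" | (All) A1 where "A = All A1"
    | (atom) "\<nexists>B C. A = Arr B C" "\<nexists>B. A = All B" by blast
  then show ?case
  proof cases
    case Arr
    have acc: "accepted (Ver A2 (App (Gen D) (Gen A1)))"
      using less.prems Arr accepted_Ver_Arr by blast
    then have "\<exists>D1 D2. D = Arr D1 D2"
      using inert_not_accepted inert.App_Gen by blast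
    then obtain D1 D2 where D: "D = Arr D1 D2" by blast
    have acc': "accepted (Ver A2 (Guard (Ver D1 (Gen A1)) (Gen D2)))"
      using accepted_Ver_pars[OF acc] pars_App_Gen D by blast
    \<comment> \<open>The guard inside the generator verifies the argument with the roles of the two
      types exchanged, hence the induction on the sum of sizes.\<close>
    then have V: "accepted (Ver D1 (Gen A1))" using inert_not_accepted inert.Guard by blast
    then have "D1 = A1" using less.hyps Arr D by simp
    moreover have "accepted (Ver A2 (Gen D2))"
      using accepted_Ver_pars[OF acc'] pars_Guard_accepted[OF V] by blast
    then have "A2 = D2" using less.hyps Arr D by simp
    ultimately show ?thesis using Arr D by simp
  next
    case All
    then have acc: "accepted (Ver (open_ty A1) (TApp (Gen (ty_eshift D)) (EVar 0)))"
      using accepted_Ver_All less.prems by fastforce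
    then have "\<exists>D1. ty_eshift D = All D1"
      using inert_not_accepted inert.TApp_Gen by blast
    then obtain D1 where D: "D = All D1" by (cases D) auto
    have "accepted (Ver (open_ty A1) (Gen (open_ty D1)))"
      using accepted_Ver_pars[OF acc] pars_TApp_Gen by (simp add: D)
    then have "open_ty A1 = open_ty D1" using less.hyps All D by (simp add: size_open_ty)
    then show ?thesis using All D close_open_ty by metis
  next
    case atom
    with less.prems show ?thesis using accepted_Ver_atom pars_Gen_Gen by metis
  qed
qed

section \<open>Typing of accepted normal forms\<close>

text \<open>The typing rules treat eigenvariables as constants, so any types may replace them,
  provided the environment changes alike.\<close>

lemma typing_sub:
  "\<Gamma> \<turnstile> M : A \<Longrightarrow> map_option (sub_ty \<theta> \<eta>) \<circ> \<Gamma> \<turnstile> sub \<theta> \<eta> Var M : sub_ty \<theta> \<eta> A"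
proof (induction arbitrary: \<theta> \<eta> rule: typing.induct)
  case (Lam A \<Gamma> M B)
  have "map_option (sub_ty \<theta> \<eta>) \<circ> case_nat (Some A) \<Gamma> =
      case_nat (Some (sub_ty \<theta> \<eta> A)) (map_option (sub_ty \<theta> \<eta>) \<circ> \<Gamma>)"
    "case_nat (Var 0) (xshift \<circ> Var) = Var"
    by (auto simp: fun_eq_iff split: nat.splits)
  with Lam.IH[of \<theta> \<eta>] show ?case unfolding sub.simps sub_ty.simps by (metis typing.Lam)
next
  case (TLam \<Gamma> M A)
  let ?\<theta> = "case_nat (TVar 0) (ty_tshift \<circ> \<theta>)" and ?\<eta> = "ty_tshift \<circ> \<eta>"
  have "sub_ty ?\<theta> ?\<eta> (ty_tshift B) = ty_tshift (sub_ty \<theta> \<eta> B)" for B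
    by (auto intro!: sub_ty_cong simp: sub_ty_ren_ty ren_ty_sub_ty)
  then have "map_option (sub_ty ?\<theta> ?\<eta>) \<circ> (map_option ty_tshift \<circ> \<Gamma>) =
      map_option ty_tshift \<circ> (map_option (sub_ty \<theta> \<eta>) \<circ> \<Gamma>)"
    by (auto simp: fun_eq_iff option.map_comp comp_def)
  moreover have "tshift \<circ> Var = Var" by (auto simp: fun_eq_iff)
  ultimately show ?case
    using TLam.IH[of ?\<theta> ?\<eta>] unfolding sub.simps sub_ty.simps by (metis typing.TLam)
next
  case (TApp \<Gamma> M A B)
  then show ?case by (auto simp: sub_ty_inst intro: typing.TApp)
next
  case (App \<Gamma> M A B N)
  then show ?case unfolding sub.simps sub_ty.simps by (blast intro: typing.App)
qed (auto intro: typing.intros)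

text \<open>Only \<open>App (Lam _) _\<close> and \<open>TApp (TLam _) _\<close> are redexes: \<open>App (TLam _) _\<close> and
  \<open>TApp (Lam _) _\<close> count as normal although they are untypable.\<close>

primrec nf :: "meta \<Rightarrow> bool" where
  "nf (Var n) = True"
| "nf (Lam M) = nf M"
| "nf (App M N) = (nf M \<and> nf N \<and> (\<nexists>L. M = Lam L))"
| "nf (TLam M) = nf M"
| "nf (TApp M A) = (nf M \<and> (\<nexists>L. M = TLam L))"
| "nf Star = False"
| "nf (Guard M N) = False"
| "nf (Gen A) = False"
| "nf (Ver A M) = False"
| "nf (Nu M) = False"

section \<open>Normal forms under reduction\<close>

lemma beta_normal_imp_nf: "pure M \<Longrightarrow> beta_normal M \<Longrightarrow> nf M"
  unfolding beta_normal_def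
  by (induction M) (auto intro: ctxt_closure.intros beta_root.intros)

text \<open>Every root rule needs a beta redex or an impure constructor, both excluded by
  \<open>nf\<close>. This makes \<open>par_nf_unique\<close> applicable to normal forms.\<close>

lemma nf_par: "nf M \<Longrightarrow> par M N \<Longrightarrow> N = M"
  by (induction M arbitrary: N) (auto elim!: par_AppE par_TAppE)

lemma pure_ren: "pure (ren \<xi> \<tau> \<epsilon> M) = pure M"
  by (induction M arbitrary: \<xi> \<tau> \<epsilon>) auto

lemma pure_sub: "pure M \<Longrightarrow> (\<And>n. pure (\<sigma> n)) \<Longrightarrow> pure (sub \<theta> \<eta> \<sigma> M)"
proof (induction M arbitrary: \<theta> \<eta> \<sigma>)
  case (Lam M)
  then show ?case by (auto simp: pure_ren split: nat.splits)
next
  case (TLam M)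
  then show ?case by (auto simp: pure_ren)
qed auto

lemma beta_red_pure: "M \<rightarrow>\<^sub>\<beta> N \<Longrightarrow> pure M \<Longrightarrow> pure N"
  by (induction rule: ctxt_closure.induct)
    (auto elim!: beta_root.cases simp: inst_eq_sub intro!: pure_sub split: nat.splits)

lemma beta_red_imp_par: "M \<rightarrow>\<^sub>\<beta> N \<Longrightarrow> par M N"
  by (induction rule: ctxt_closure.induct) (auto elim!: beta_root.cases intro: par.intros)

text \<open>
  Instantiating the variable bound by \<open>Lam\<close> with a generator lowers the indices of the variables
  outside the environment, so the induction allows them to be renamed.
\<close>

definition gen_subst :: "env \<Rightarrow> (nat \<Rightarrow> meta) \<Rightarrow> bool" where
  "gen_subst \<Gamma> \<sigma> \<longleftrightarrow> (\<forall>n. case \<Gamma> n of None \<Rightarrow> \<exists>k. \<sigma> n = Var k | Some A \<Rightarrow> \<sigma> n = Gen A)"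

lemma gen_subst_lift:
  assumes "gen_subst \<Gamma> \<sigma>"
  shows "gen_subst (case_nat (Some A) \<Gamma>) (case_nat (Gen A) \<sigma>)"
    and "gen_subst (map_option ty_eshift \<circ> \<Gamma>) (eshift \<circ> \<sigma>)"
proof -
  have \<sigma>: "case \<Gamma> n of None \<Rightarrow> \<exists>k. \<sigma> n = Var k | Some A \<Rightarrow> \<sigma> n = Gen A" for n
    using assms unfolding gen_subst_def by (rule spec)
  show "gen_subst (case_nat (Some A) \<Gamma>) (case_nat (Gen A) \<sigma>)"
    unfolding gen_subst_def using \<sigma> by (auto split: nat.split)
  show "gen_subst (map_option ty_eshift \<circ> \<Gamma>) (eshift \<circ> \<sigma>)"
    unfolding gen_subst_def
  proof
    fix n
    show "case (map_option ty_eshift \<circ> \<Gamma>) n of None \<Rightarrow> \<exists>k. (eshift \<circ> \<sigma>) n = Var k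
        | Some A \<Rightarrow> (eshift \<circ> \<sigma>) n = Gen A"
      using \<sigma>[of n] by (cases "\<Gamma> n") auto
  qed
qed

text \<open>Hides the lifted substitution behind \<open>M'\<close> and keeps only what a later
  contraction needs; \<open>subst_TLam\<close> does the same for type abstractions.\<close>

lemma subst_Lam:
  obtains M' where "subst \<sigma> (Lam M) = Lam M'"
    and "\<And>N. M'[0 :=\<^sub>x N] = subst (case_nat N \<sigma>) M"
proof
  show "subst \<sigma> (Lam M) = Lam (subst (case_nat (Var 0) (xshift \<circ> \<sigma>)) M)" by simp
  show "(subst (case_nat (Var 0) (xshift \<circ> \<sigma>)) M)[0 :=\<^sub>x N] = subst (case_nat N \<sigma>) M" for N
    unfolding inst_eq_sub subst_eq_sub sub_sub
    by (rule sub_cong) (auto simp: sub_ren comp_def split: nat.splits)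
qed

abbreviation open_meta :: "meta \<Rightarrow> meta" where
  "open_meta \<equiv> sub (case_nat (EVar 0) TVar) (EVar \<circ> Suc) Var"

lemma subst_TLam:
  obtains M' where "subst \<sigma> (TLam M) = TLam M'"
    and "(eshift M')[0 :=\<^sub>t EVar 0] = subst (eshift \<circ> \<sigma>) (open_meta M)"
proof
  show "subst \<sigma> (TLam M) = TLam (subst (tshift \<circ> \<sigma>) M)" by simp
  show "(eshift (subst (tshift \<circ> \<sigma>) M))[0 :=\<^sub>t EVar 0] = subst (eshift \<circ> \<sigma>) (open_meta M)"
    unfolding inst_eq_sub subst_eq_sub sub_ren sub_sub
    by (rule sub_cong) (auto simp: sub_ren comp_def split: nat.splits, simp_all add: ren_eq_sub comp_def)
qed

text \<open>Applying \<open>close_ty\<close> throughout the derivation turns the opening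
  eigenvariable back into the bound type variable. Its freshness for the environment becomes the
  side condition of the typing rule.\<close>

lemma typing_TLam_open:
  assumes "map_option ty_eshift \<circ> \<Gamma> \<turnstile> open_meta M : open_ty A"
  shows "\<Gamma> \<turnstile> TLam M : All A"
proof (rule typing.TLam)
  let ?\<theta> = "TVar \<circ> Suc" and ?\<eta> = "case_nat (TVar 0) EVar"
  have "close_ty (ty_eshift B) = ty_tshift B" for B
    unfolding close_ty_def ren_ty_eq_sub_ty sub_ty_sub_ty by (rule sub_ty_cong) auto
  then have "map_option close_ty \<circ> (map_option ty_eshift \<circ> \<Gamma>) = map_option ty_tshift \<circ> \<Gamma>"
    by (auto simp: fun_eq_iff option.map_comp comp_def)
  moreover have "sub ?\<theta> ?\<eta> Var (open_meta M) = sub TVar EVar Var M"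
    unfolding sub_sub by (rule sub_cong) (auto split: nat.splits)
  ultimately show "map_option ty_tshift \<circ> \<Gamma> \<turnstile> M : A"
    using typing_sub[OF assms, of ?\<theta> ?\<eta>] close_open_ty[of A] by (simp add: close_ty_def)
qed

text \<open>As in bidirectional typing, neutral metaterms synthesize a type \<open>D\<close>, or get
  stuck, while abstractions are checked against a given type.\<close>

definition head_normalizes :: "env \<Rightarrow> (nat \<Rightarrow> meta) \<Rightarrow> meta \<Rightarrow> bool" where
  "head_normalizes \<Gamma> \<sigma> M \<longleftrightarrow> (\<exists>X. par\<^sup>*\<^sup>* (subst \<sigma> M) X \<and> inert X) \<or>
    (\<exists>D. par\<^sup>*\<^sup>* (subst \<sigma> M) (Gen D) \<and> \<Gamma> \<turnstile> M : D)"

text \<open>Acceptance excludes the inert case, and \<open>accepted_Gen\<close> identifies the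
  synthesized type with the verified one.\<close>

lemma head_normalizes_typing:
  assumes "head_normalizes \<Gamma> \<sigma> M" and "accepted (Ver A (subst \<sigma> M))"
  shows "\<Gamma> \<turnstile> M : A"
  using assms accepted_Ver_pars inert_not_accepted accepted_Gen
  unfolding head_normalizes_def by metis

text \<open>Unfolding the generator of an arrow type guards the result by a verification of the
  argument: success types the argument, failure leaves an inert guard.\<close>

lemma head_normalizes_App:
  assumes "head_normalizes \<Gamma> \<sigma> M" and "\<And>A. accepted (Ver A (subst \<sigma> N)) \<Longrightarrow> \<Gamma> \<turnstile> N : A"
  shows "head_normalizes \<Gamma> \<sigma> (App M N)"
proof -
  let ?N = "subst \<sigma> N"
  have app: "par\<^sup>*\<^sup>* (subst \<sigma> (App M N)) (App X ?N)" if "par\<^sup>*\<^sup>* (subst \<sigma> M) X" for X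
    using pars_congs(2)[OF that] by simp
  show ?thesis
  proof (cases "\<exists>D1 D2. par\<^sup>*\<^sup>* (subst \<sigma> M) (Gen (Arr D1 D2)) \<and> \<Gamma> \<turnstile> M : Arr D1 D2")
    case True
    then obtain D1 D2 where D: "par\<^sup>*\<^sup>* (subst \<sigma> M) (Gen (Arr D1 D2))" "\<Gamma> \<turnstile> M : Arr D1 D2" by blast
    have red: "par\<^sup>*\<^sup>* (subst \<sigma> (App M N)) (Guard (Ver D1 ?N) (Gen D2))"
      using app[OF D(1)] pars_App_Gen by (rule rtranclp_trans)
    show ?thesis
    proof (cases "accepted (Ver D1 ?N)")
      case True
      then have "par\<^sup>*\<^sup>* (subst \<sigma> (App M N)) (Gen D2)"
        using red pars_Guard_accepted rtranclp_trans[of par] by metis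
      with assms(2)[OF True] D(2) show ?thesis
        unfolding head_normalizes_def using typing.App by blast
    next
      case False
      with red show ?thesis unfolding head_normalizes_def using inert.Guard by blast
    qed
  next
    case False
    with assms(1) app show ?thesis
      unfolding head_normalizes_def using inert.App inert.App_Gen by metis
  qed
qed

lemma head_normalizes_TApp:
  assumes "head_normalizes \<Gamma> \<sigma> M"
  shows "head_normalizes \<Gamma> \<sigma> (TApp M B)"
proof -
  have app: "par\<^sup>*\<^sup>* (subst \<sigma> (TApp M B)) (TApp X B)" if "par\<^sup>*\<^sup>* (subst \<sigma> M) X" for X
    using pars_congs(3)[OF that] by simp
  show ?thesis
  proof (cases "\<exists>D. par\<^sup>*\<^sup>* (subst \<sigma> M) (Gen (All D)) \<and> \<Gamma> \<turnstile> M : All D")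
    case True
    then obtain D where D: "par\<^sup>*\<^sup>* (subst \<sigma> M) (Gen (All D))" "\<Gamma> \<turnstile> M : All D" by blast
    have "par\<^sup>*\<^sup>* (subst \<sigma> (TApp M B)) (Gen (D[0 :=\<^sub>a B]))"
      using app[OF D(1)] pars_TApp_Gen by (rule rtranclp_trans)
    with D(2) show ?thesis unfolding head_normalizes_def using typing.TApp by blast
  next
    case False
    with assms app show ?thesis
      unfolding head_normalizes_def using inert.TApp inert.TApp_Gen by metis
  qed
qed

text \<open>At a universal type the expansion gives an inert type application of an abstraction, and
  at an atom the abstraction would have to reduce to a generator. \<open>accepted_TLam\<close> is
  dual.\<close>

lemma accepted_Lam:
  assumes "accepted (Ver A (subst \<sigma> (Lam M)))"
  obtains B C where "A = Arr B C" and "accepted (Ver C (subst (case_nat (Gen B) \<sigma>) M))"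
proof -
  obtain M' where M': "subst \<sigma> (Lam M) = Lam M'"
    "\<And>N. M'[0 :=\<^sub>x N] = subst (case_nat N \<sigma>) M"
    using subst_Lam by blast
  consider (Arr) A1 A2 where "A = Arr A1 A2" | (All) A1 where "A = All A1"
    | (atom) "\<nexists>B C. A = Arr B C" "\<nexists>B. A = All B" by blast
  then show thesis
  proof cases
    case Arr
    then have "accepted (Ver A2 (App (Lam M') (Gen A1)))"
      using assms accepted_Ver_Arr M'(1) by simp
    then have "accepted (Ver A2 (M'[0 :=\<^sub>x Gen A1]))"
      by (rule accepted_Ver_pars) (simp add: par.beta r_into_rtranclp)
    then show thesis using that Arr M'(2) by simp
  next
    case All
    then have "accepted (Ver (open_ty A1) (TApp (eshift (Lam M')) (EVar 0)))"
      using assms accepted_Ver_All M'(1) by metis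
    then show thesis using inert_not_accepted inert.TApp_Lam by auto
  next
    case atom
    with assms M'(1) have "par\<^sup>*\<^sup>* (Lam M') (Gen A)" using accepted_Ver_atom by metis
    then show thesis using pars_value(1) by blast
  qed
qed

lemma accepted_TLam:
  assumes "accepted (Ver A (subst \<sigma> (TLam M)))"
  obtains B where "A = All B"
    and "accepted (Ver (open_ty B) (subst (eshift \<circ> \<sigma>) (open_meta M)))"
proof -
  obtain M' where M': "subst \<sigma> (TLam M) = TLam M'"
    "(eshift M')[0 :=\<^sub>t EVar 0] = subst (eshift \<circ> \<sigma>) (open_meta M)"
    using subst_TLam by blast
  consider (Arr) A1 A2 where "A = Arr A1 A2" | (All) A1 where "A = All A1"
    | (atom) "\<nexists>B C. A = Arr B C" "\<nexists>B. A = All B" by blast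
  then show thesis
  proof cases
    case Arr
    then have "accepted (Ver A2 (App (TLam M') (Gen A1)))"
      using assms accepted_Ver_Arr M'(1) by simp
    then show thesis using inert_not_accepted inert.App_TLam by blast
  next
    case All
    then have "accepted (Ver (open_ty A1) (TApp (eshift (TLam M')) (EVar 0)))"
      using assms accepted_Ver_All M'(1) by metis
    then have "accepted (Ver (open_ty A1) ((eshift M')[0 :=\<^sub>t EVar 0]))"
      by (rule accepted_Ver_pars) (simp add: par.tbeta r_into_rtranclp)
    then show thesis using that All M'(2) by simp
  next
    case atom
    with assms M'(1) have "par\<^sup>*\<^sup>* (TLam M') (Gen A)" using accepted_Ver_atom by metis
    then show thesis using pars_value(2) by blast
  qed
qed

text \<open>
  The substitution \<open>\<theta>\<close>, \<open>\<eta>\<close> makes structural induction applicable to \<open>TLam\<close>, whose body is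
  verified after being opened with an eigenvariable.
\<close>

lemma accepted_nf_typing:
  assumes "nf N" and "gen_subst \<Gamma> \<sigma>"
  shows "(accepted (Ver A (subst \<sigma> (sub \<theta> \<eta> Var N))) \<longrightarrow> \<Gamma> \<turnstile> sub \<theta> \<eta> Var N : A) \<and>
    ((\<exists>L. N = Lam L) \<or> (\<exists>L. N = TLam L) \<or> head_normalizes \<Gamma> \<sigma> (sub \<theta> \<eta> Var N))"
  using assms
proof (induction N arbitrary: A \<Gamma> \<sigma> \<theta> \<eta>)
  case (Var n)
  have \<sigma>: "case \<Gamma> n of None \<Rightarrow> \<exists>k. \<sigma> n = Var k | Some A \<Rightarrow> \<sigma> n = Gen A"
    using Var.prems(2) unfolding gen_subst_def by (rule spec)
  \<comment> \<open>As in the other neutral cases, this claim comes first and yields the typing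
    claim through \<open>head_normalizes_typing\<close>.\<close>
  have hn: "head_normalizes \<Gamma> \<sigma> (sub \<theta> \<eta> Var (Var n))"
  proof (cases "\<Gamma> n")
    case None
    with \<sigma> have "inert (subst \<sigma> (Var n))" by (auto intro: inert.Var)
    then show ?thesis unfolding head_normalizes_def sub.simps by blast
  next
    case (Some B)
    with \<sigma> have "par\<^sup>*\<^sup>* (subst \<sigma> (Var n)) (Gen B)" by simp
    moreover have "\<Gamma> \<turnstile> Var n : B" using Some by (rule typing.Var)
    ultimately show ?thesis unfolding head_normalizes_def sub.simps by blast
  qed
  show ?case by (intro conjI impI disjI2 hn, erule head_normalizes_typing[OF hn])
next
  case (App M N)
  have nf: "nf M" "nf N" "\<nexists>L. M = Lam L" using App.prems(1) by simp_all
  have hn: "head_normalizes \<Gamma> \<sigma> (sub \<theta> \<eta> Var (App M N))"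
  \<comment> \<open>The induction hypothesis says nothing about the head normalization of a type
    abstraction, but applying one to a metaterm is inert outright.\<close>
  proof (cases "\<exists>L. M = TLam L")
    case True
    then have "inert (subst \<sigma> (sub \<theta> \<eta> Var (App M N)))"
      by (elim exE) (simp add: inert.App_TLam)
    then show ?thesis unfolding head_normalizes_def by blast
  next
    case False
    then have "head_normalizes \<Gamma> \<sigma> (sub \<theta> \<eta> Var M)"
      using App.IH(1)[OF nf(1) App.prems(2), where \<theta> = \<theta> and \<eta> = \<eta>] nf(3) by blast
    moreover have "\<Gamma> \<turnstile> sub \<theta> \<eta> Var N : B"
      if "accepted (Ver B (subst \<sigma> (sub \<theta> \<eta> Var N)))" for B
      using App.IH(2)[OF nf(2) App.prems(2)] that by blast
    ultimately show ?thesis unfolding sub.simps by (rule head_normalizes_App)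
  qed
  show ?case by (intro conjI impI disjI2 hn, erule head_normalizes_typing[OF hn])
next
  case (TApp M B)
  have nf: "nf M" "\<nexists>L. M = TLam L" using TApp.prems(1) by simp_all
  have hn: "head_normalizes \<Gamma> \<sigma> (sub \<theta> \<eta> Var (TApp M B))"
  proof (cases "\<exists>L. M = Lam L")
    case True
    then have "inert (subst \<sigma> (sub \<theta> \<eta> Var (TApp M B)))"
      by (elim exE) (simp add: inert.TApp_Lam)
    then show ?thesis unfolding head_normalizes_def by blast
  next
    case False
    then have "head_normalizes \<Gamma> \<sigma> (sub \<theta> \<eta> Var M)"
      using TApp.IH[OF nf(1) TApp.prems(2), where \<theta> = \<theta> and \<eta> = \<eta>] nf(2) by blast
    then show ?thesis unfolding sub.simps by (rule head_normalizes_TApp)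
  qed
  show ?case by (intro conjI impI disjI2 hn, erule head_normalizes_typing[OF hn])
next
  case (Lam M)
  have nf: "nf M" using Lam.prems(1) by simp
  have ups: "case_nat (Var 0) (xshift \<circ> Var) = Var" by (auto simp: fun_eq_iff split: nat.splits)
  have typed: "\<Gamma> \<turnstile> Lam (sub \<theta> \<eta> Var M) : A" if "accepted (Ver A (subst \<sigma> (Lam (sub \<theta> \<eta> Var M))))"
    using that
  proof (rule accepted_Lam)
    fix B C
    assume A: "A = Arr B C"
      and acc: "accepted (Ver C (subst (case_nat (Gen B) \<sigma>) (sub \<theta> \<eta> Var M)))"
    have "case_nat (Some B) \<Gamma> \<turnstile> sub \<theta> \<eta> Var M : C"
      by (rule Lam.IH[OF nf gen_subst_lift(1)[OF Lam.prems(2)], THEN conjunct1, THEN mp, OF acc])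
    then show ?thesis unfolding A by (rule typing.Lam)
  qed
  show ?case unfolding sub.simps ups by (rule conjI, rule impI, erule typed, simp)
next
  case (TLam M)
  have nf: "nf M" using TLam.prems(1) by simp
  let ?\<theta> = "case_nat (TVar 0) (ty_tshift \<circ> \<theta>)" and ?\<eta> = "ty_tshift \<circ> \<eta>"
  have ups: "tshift \<circ> Var = Var" by (auto simp: fun_eq_iff)
  have typed: "\<Gamma> \<turnstile> TLam (sub ?\<theta> ?\<eta> Var M) : A" if "accepted (Ver A (subst \<sigma> (TLam (sub ?\<theta> ?\<eta> Var M))))"
    using that
  proof (rule accepted_TLam)
    fix B
    let ?open = "sub_ty (case_nat (EVar 0) TVar) (EVar \<circ> Suc)"
    assume A: "A = All B"
      and acc: "accepted (Ver (open_ty B) (subst (eshift \<circ> \<sigma>) (open_meta (sub ?\<theta> ?\<eta> Var M))))"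
    \<comment> \<open>Opening is absorbed into the accumulated type substitution, which leaves
      \<open>M\<close> itself to the induction hypothesis.\<close>
    have eq: "open_meta (sub ?\<theta> ?\<eta> Var M) = sub (?open \<circ> ?\<theta>) (?open \<circ> ?\<eta>) Var M"
      unfolding sub_sub by (rule sub_cong) auto
    have "map_option ty_eshift \<circ> \<Gamma> \<turnstile> open_meta (sub ?\<theta> ?\<eta> Var M) : open_ty B"
      unfolding eq
      by (rule TLam.IH[OF nf gen_subst_lift(2)[OF TLam.prems(2)], THEN conjunct1, THEN mp,
            OF acc[unfolded eq]])
    then show ?thesis unfolding A by (rule typing_TLam_open)
  qed
  show ?case unfolding sub.simps ups by (rule conjI, rule impI, erule typed, simp)
qed simp_all

theorem theorem4p14:
  fixes \<Gamma> :: env and A :: ty and M :: meta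
  assumes "is_env \<Gamma>"
    and "good M"
    and "Ver A (gen_env \<Gamma> M) \<rightarrow>\<^sub>m\<^sup>* Star"
  shows "pure (M\<down>) \<and> \<Gamma> \<turnstile> M\<down> : A"
proof -
  let ?\<sigma> = "\<lambda>n. case \<Gamma> n of None \<Rightarrow> Var n | Some A \<Rightarrow> Gen A"
  have pure_pars: "pure N \<and> par\<^sup>*\<^sup>* M N" if "M \<rightarrow>\<^sub>\<beta>\<^sup>* N" for N
    using that
  proof (induction rule: rtranclp_induct)
    case base
    then show ?case using \<open>good M\<close> by (simp add: good_def)
  next
    case (step N P)
    then show ?case
      by (meson beta_red_pure beta_red_imp_par rtranclp.rtrancl_into_rtrancl)
  qed
  obtain N where N: "is_beta_nf M N"
    using \<open>good M\<close> unfolding good_def beta_normalizing_def by blast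
  have nf: "nf P \<and> par\<^sup>*\<^sup>* M P" if "is_beta_nf M P" for P
    using that pure_pars beta_normal_imp_nf unfolding is_beta_nf_def by blast
  \<comment> \<open>Uniqueness identifies the definite description in \<open>beta_nf\<close> with
    \<open>N\<close>.\<close>
  have "P = N" if P: "is_beta_nf M P" for P
  proof -
    have "par\<^sup>*\<^sup>* P N"
      using nf[OF N] nf[OF P] nf_par by (intro par_nf_unique[of M N P]) auto
    then have "N = P"
      by (induction rule: rtranclp_induct) (use nf[OF P] nf_par in auto)
    then show ?thesis by simp
  qed
  with N have M: "M\<down> = N" unfolding beta_nf_def by (rule the_equality)
  have "par\<^sup>*\<^sup>* (Ver A (subst ?\<sigma> M)) Star"
    using assms(3) unfolding gen_env_def
    by (rule rtranclp_mono[THEN predicate2D, rotated]) (auto intro: red_imp_par)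
  \<comment> \<open>Parallel steps survive the insertion of generators, so acceptance passes from
    \<open>M\<close> to its normal form.\<close>
  moreover have "par\<^sup>*\<^sup>* (subst ?\<sigma> M) (subst ?\<sigma> N)"
    using nf[OF N, THEN conjunct2]
    by (induction rule: rtranclp_induct) (simp, meson par_subst rtranclp.rtrancl_into_rtrancl)
  ultimately have "accepted (Ver A (subst ?\<sigma> N))" by (rule accepted_Ver_pars)
  moreover have "gen_subst \<Gamma> ?\<sigma>" by (auto simp: gen_subst_def split: option.splits)
  \<comment> \<open>The induction is entered with the identity substitution on type variables and
    eigenvariables.\<close>
  ultimately have "\<Gamma> \<turnstile> N : A"
    using accepted_nf_typing[of N \<Gamma> ?\<sigma> A TVar EVar] nf[OF N] by simp
  then show ?thesis using M N pure_pars unfolding is_beta_nf_def by simp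
qed

end
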